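(* Let $n\ge 1$ and let $X_1,X_2,\ldots,X_n$ be independent, identically distributed real random variables with continuous cumulative distribution function $F$. For $i=1,\ldots,n$ let $R_i$ be the rank of $X_i$ among $X_1,\ldots,X_n$, and let $U_i=\frac{R_i}{n+1}$ be the corresponding pseudo-observation. Then each pseudo-observation $U_i$ is the expected value of the order statistic of $F(X_1),\ldots,F(X_n)$ whose index is the rank of $X_i$; that is, for every $i\in\{1,\ldots,n\}$ and every $r\in\{1,\ldots,n\}$, on the event $\{R_i=r\}$ one has $$U_i=\frac{r}{n+1}=E\left[F(X)_{(r)}\right],$$ where $F(X)_{(r)}$ denotes the $r$th order statistic of $F(X_1),\ldots,F(X_n)$ and the expectation is taken with the index $r$ held fixed.
   Context: The order statistics of real random variables $Y_1,\ldots,Y_n$ are the values arranged in ascending order, $Y_{(1)}\le Y_{(2)}\le\cdots\le Y_{(n)}$, and $Y_{(r)}$ is called the $r$th order statistic. The notation $F(X)_{(r)}$ means the $r$th order statistic of the sample $F(X_1),\ldots,F(X_n)$. The rank of $X_i$ among $X_1,\ldots,X_n$ is $R_i=\sum_{k=1}^n \mathbf{1}(X_k\le X_i)$, where $\mathbf 1(A)$ is the indicator function of the event $A$. *)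

theory Defs
  imports "HOL-Probability.Probability"
begin

(* A sample of size n is a function on nat, of which only the values at 1, ..., n matter. *)

definition sample_rank :: "nat \<Rightarrow> (nat \<Rightarrow> real) \<Rightarrow> nat \<Rightarrow> nat" where
  "sample_rank n y i = (\<Sum>k=1..n. of_bool (y k \<le> y i))"

definition pseudo_observation :: "nat \<Rightarrow> (nat \<Rightarrow> real) \<Rightarrow> nat \<Rightarrow> real" where
  "pseudo_observation n y i = real (sample_rank n y i) / (real n + 1)"

(* Order statistics are indexed from 1, list positions from 0; meaningful for 1 <= r <= n. *)
definition order_statistic :: "nat \<Rightarrow> (nat \<Rightarrow> real) \<Rightarrow> nat \<Rightarrow> real" where
  "order_statistic n y r = sort (map y [1..<Suc n]) ! (r - 1)"

end

theory Submission
  imports Defs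
begin

text \<open>
  By the probability integral transform \<open>F(X\<^sub>1), \<dots>, F(X\<^sub>n)\<close> are independent and uniform on
  \<open>[0, 1]\<close>, so the number of them below \<open>t\<close> is binomial with parameters \<open>n\<close> and \<open>t\<close>.  The
  \<open>r\<close>th order statistic exceeds \<open>t\<close> iff that number is less than \<open>r\<close>; integrating this tail
  over \<open>t\<close> gives a sum of \<open>r\<close> integrals of Bernstein polynomials of degree \<open>n\<close>, each equal to
  \<open>1/(n+1)\<close>.
\<close>

text \<open>In a sorted list the entries that are at most t form an initial segment, and sorting
  keeps their number. Position i, counted from 0, lies beyond this segment exactly when the segment
  has length at most i.\<close>

lemma less_sort_nth_iff:
  fixes xs :: "'a::linorder list"
  assumes "i < length xs"
  shows "t < sort xs ! i \<longleftrightarrow> length (filter (\<lambda>x. x \<le> t) xs) \<le> i"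
proof -
  define ys where "ys = sort xs"
  define zs where "zs = takeWhile (\<lambda>x. x \<le> t) ys"
  have sorted: "sorted ys"
    by (simp add: ys_def)
  have len: "length ys = length xs"
    by (simp add: ys_def)
  have "filter (\<lambda>x. x \<le> t) ys = zs"
    unfolding zs_def using sorted
    by (induction ys) (auto simp: filter_empty_conv takeWhile_eq_Nil_iff hd_in_set not_le intro: less_le_trans)
  then have length_eq: "length (filter (\<lambda>x. x \<le> t) xs) = length zs"
    by (metis filter_sort length_sort ys_def sort_key_id_if_sorted)
  show ?thesis
  proof (cases "i < length zs")
    case True
    then have "ys ! i \<le> t"
      unfolding zs_def by (metis nth_mem set_takeWhileD takeWhile_nth)
    with True show ?thesis
      by (simp add: length_eq ys_def)
  next
    case False
    then have "length zs < length ys"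
      using assms len by simp
    \<comment> \<open>This is the first entry that fails the test of \<open>takeWhile\<close>;
      sortedness carries the bound on to position i.\<close>
    then have "t < ys ! length zs"
      unfolding zs_def using nth_length_takeWhile by fastforce
    also have "\<dots> \<le> ys ! i"
      using sorted False assms len by (intro sorted_nth_mono) auto
    finally show ?thesis
      using False by (simp add: length_eq ys_def)
  qed
qed

text \<open>Replaces an event about the sorted sample by one about a count, which independence can
  handle. The list position is r - 1, so "at most r - 1" becomes "less than r" because r is at least
  1.\<close>

lemma less_order_statistic_iff:
  assumes "r \<in> {1..n}"
  shows "t < order_statistic n y r \<longleftrightarrow> card {k\<in>{1..n}. y k \<le> t} < r"
proof -
  have "length (filter (\<lambda>x. x \<le> t) (map y [1..<Suc n])) =
      card (set (filter (\<lambda>k. y k \<le> t) [1..<Suc n]))"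
    by (subst distinct_card) (simp_all add: filter_map comp_def del: upt_Suc)
  also have "set (filter (\<lambda>k. y k \<le> t) [1..<Suc n]) = {k\<in>{1..n}. y k \<le> t}"
    by auto
  finally show ?thesis
    unfolding order_statistic_def using assms
    by (subst less_sort_nth_iff) (auto simp del: upt_Suc)
qed

lemma order_statistic_in:
  assumes "r \<in> {1..n}" "y ` {1..n} \<subseteq> A"
  shows "order_statistic n y r \<in> A"
proof -
  have "order_statistic n y r \<in> set (sort (map y [1..<Suc n]))"
    unfolding order_statistic_def using assms(1)
    by (intro nth_mem) (auto simp del: upt_Suc)
  then show ?thesis
    using assms(2) by (auto simp: less_Suc_eq_le simp del: upt_Suc)
qed

text \<open>The event splits according to the exact set S of indices whose variables fall into B. By
  independence each S of size j contributes the same product, and there are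
  \<open>card I choose j\<close> such sets.\<close>

lemma (in prob_space) prob_card_eq_binomial:
  assumes indep: "indep_vars (\<lambda>_. N) X I" and "finite I" and B: "B \<in> sets N"
    and p: "\<And>i. i \<in> I \<Longrightarrow> prob (X i -` B \<inter> space M) = p"
  shows "prob {\<omega>\<in>space M. card {i\<in>I. X i \<omega> \<in> B} = j} =
    real (card I choose j) * p ^ j * (1 - p) ^ (card I - j)"
proof -
  define E where "E S = {\<omega>\<in>space M. {i\<in>I. X i \<omega> \<in> B} = S}" for S
  have X_meas [measurable]: "X i \<in> measurable M N" if "i \<in> I" for i
    using indep that by (auto simp: indep_vars_def)
  have meas: "X i -` (if i \<in> S then B else space N - B) \<inter> space M \<in> events" if "i \<in> I" for i S
    using that B by auto
  have E_eq: "E S = space M \<inter> (\<Inter>i\<in>I. X i -` (if i \<in> S then B else space N - B) \<inter> space M)"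
    if "S \<subseteq> I" for S
    using that measurable_space[OF X_meas]
    by (auto simp: E_def split: if_splits)
  have E_meas: "E S \<in> events" if "S \<subseteq> I" for S
  \<comment> \<open>An intersection over no indices would be the whole type; the factor
    \<open>space M\<close> in \<open>E_eq\<close> covers this case, and the rules for finite
    intersections need a nonempty index set.\<close>
  proof (cases "I = {}")
    case False
    then show ?thesis
      unfolding E_eq[OF that] using \<open>finite I\<close>
      by (intro sets.Int sets.top sets.finite_INT meas)
  qed (use E_eq[OF that] in simp)
  have prob_E: "prob (E S) = p ^ card S * (1 - p) ^ (card I - card S)" if "S \<subseteq> I" for S
  proof (cases "I = {}")
    case True
    then show ?thesis using that by (simp add: E_def prob_space)
  next
    case False
    let ?A = "\<lambda>i. X i -` (if i \<in> S then B else space N - B) \<inter> space M"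
    have compl: "prob (X i -` (space N - B) \<inter> space M) = 1 - p" if "i \<in> I" for i
    proof -
      have "X i -` (space N - B) \<inter> space M = space M - (X i -` B \<inter> space M)"
        using measurable_space[of "X i" M N] that by auto
      then show ?thesis
        using that p[of i] B by (simp add: prob_compl)
    qed
    have "prob (E S) = prob (\<Inter>i\<in>I. ?A i)"
      unfolding E_eq[OF that] using False by (intro arg_cong[where f = prob]) auto
    also have "\<dots> = (\<Prod>i\<in>I. prob (?A i))"
      using False \<open>finite I\<close> B by (intro indep_varsD[OF indep]) auto
    also have "\<dots> = (\<Prod>i\<in>I. if i \<in> S then p else 1 - p)"
      by (intro prod.cong) (auto simp: p compl)
    also have "\<dots> = p ^ card S * (1 - p) ^ card (I - S)"
      using that \<open>finite I\<close> by (simp add: prod.If_cases Int_absorb1 Diff_eq)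
    finally show ?thesis
      using that \<open>finite I\<close> by (simp add: card_Diff_subset finite_subset)
  qed
  have "{\<omega>\<in>space M. card {i\<in>I. X i \<omega> \<in> B} = j} = (\<Union>S\<in>{S. S \<subseteq> I \<and> card S = j}. E S)"
    by (auto simp: E_def)
  also have "prob \<dots> = (\<Sum>S\<in>{S. S \<subseteq> I \<and> card S = j}. prob (E S))"
    using \<open>finite I\<close> E_meas
    by (intro finite_measure_finite_Union) (auto simp: disjoint_family_on_def E_def)
  also have "\<dots> = (\<Sum>S\<in>{S. S \<subseteq> I \<and> card S = j}. p ^ j * (1 - p) ^ (card I - j))"
    by (intro sum.cong) (auto simp: prob_E)
  also have "\<dots> = real (card I choose j) * p ^ j * (1 - p) ^ (card I - j)"
    using n_subsets[OF \<open>finite I\<close>, of j] by simp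
  finally show ?thesis .
qed

text \<open>The cdf may have plateaus and hence no inverse, so the event is compared with half-lines
  \<open>{..x}\<close> at points x where the cdf takes a prescribed value. Such points exist by the
  intermediate value theorem and the limits 0 and 1.\<close>

lemma (in real_distribution) prob_cdf_le:
  assumes cont: "continuous_on UNIV (cdf M)" and t: "0 < t" "t < 1"
  shows "prob {x. cdf M x \<le> t} = t"
proof -
  have [measurable]: "cdf M \<in> borel_measurable borel"
    using cont by (rule borel_measurable_continuous_onI)
  have meas: "{x. cdf M x \<le> t} \<in> events"
    by simp
  have quantile: "\<exists>x. cdf M x = s" if "0 < s" "s < 1" for s
  proof -
    have "eventually (\<lambda>x. cdf M x < s) at_bot" "eventually (\<lambda>x. s < cdf M x) at_top"
      using order_tendstoD[OF cdf_lim_at_bot] order_tendstoD[OF cdf_lim_at_top_prob] that by auto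
    then obtain a b where "cdf M a < s" "s < cdf M b"
      using eventually_happens' trivial_limit_at_bot_linorder trivial_limit_at_top_linorder by metis
    moreover from this have "a \<le> b"
      using cdf_nondecreasing[of b a] by linarith
    ultimately show ?thesis
      using IVT'[of "cdf M" a s b] continuous_on_subset[OF cont, of "{a..b}"] by auto
  qed
  show ?thesis
  proof (rule antisym)
    show "prob {x. cdf M x \<le> t} \<le> t"
    \<comment> \<open>A point x with value exactly t might not bound the event, since a plateau at
      level t can extend to its right. A value s > t does give an upper bound, and s is arbitrarily
      close to t.\<close>
    proof (rule dense_ge_bounded[OF t(2)])
      fix s assume s: "t < s" "s < 1"
      then obtain x where x: "cdf M x = s"
        using quantile[of s] t by auto
      have "{x. cdf M x \<le> t} \<subseteq> {..x}"
        using cdf_nondecreasing[of x] x s by (auto simp: not_le) (metis less_imp_le linorder_not_le order_trans)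
      then have "prob {x. cdf M x \<le> t} \<le> prob {..x}"
        by (intro finite_measure_mono) auto
      then show "prob {x. cdf M x \<le> t} \<le> s"
        using x by (simp add: cdf_def)
    qed
    obtain x where x: "cdf M x = t"
      using quantile t by auto
    have "prob {..x} \<le> prob {x. cdf M x \<le> t}"
      using x meas by (intro finite_measure_mono) (auto intro: cdf_nondecreasing)
    then show "t \<le> prob {x. cdf M x \<le> t}"
      using x by (simp add: cdf_def)
  qed
qed

text \<open>A Beta integral: B(j+1, n-j+1) = j! (n-j)! / (n+1)!, and the binomial coefficient
  cancels all but 1/(n+1).\<close>

lemma has_integral_Bernstein:
  assumes "j \<le> n"
  shows "((\<lambda>t. real (n choose j) * t ^ j * (1 - t) ^ (n - j)) has_integral 1 / (real n + 1)) {0<..<1}"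
proof -
  have "((\<lambda>t. t powr (real (Suc j) - 1) * (1 - t) powr (real (Suc (n - j)) - 1)) has_integral
      Beta (real (Suc j)) (real (Suc (n - j)))) {0<..<1}"
    using has_integral_Beta_real[of "real (Suc j)" "real (Suc (n - j))"]
    by (simp add: has_integral_Icc_iff_Ioo)
  \<comment> \<open>On the open interval both bases are positive, so \<open>powr\<close> agrees with
    the natural power; at an endpoint \<open>0 powr 0\<close> is 0 while \<open>0 ^ 0\<close> is
    1.\<close>
  then have "((\<lambda>t. t ^ j * (1 - t) ^ (n - j)) has_integral Beta (real (Suc j)) (real (Suc (n - j)))) {0<..<1}"
    by (rule has_integral_eq[rotated]) (auto simp: powr_realpow)
  then have "((\<lambda>t. real (n choose j) * (t ^ j * (1 - t) ^ (n - j))) has_integral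
      real (n choose j) * Beta (real (Suc j)) (real (Suc (n - j)))) {0<..<1}"
    by (rule has_integral_mult_right)
  moreover have "Beta (real (Suc j)) (real (Suc (n - j))) = fact j * fact (n - j) / fact (Suc n)"
    using assms Gamma_fact[of j, where 'a = real] Gamma_fact[of "n - j", where 'a = real]
      Gamma_fact[of "Suc n", where 'a = real]
    by (simp add: Beta_def of_nat_diff algebra_simps)
  ultimately show ?thesis
    using assms by (simp add: binomial_fact mult.assoc add.commute)
qed

text \<open>Layer-cake argument: \<open>Y \<omega>\<close> is the length of the set of t with 0 < t
  < \<open>Y \<omega>\<close>, and Tonelli's theorem exchanges the integrals over t and
  \<omega>.\<close>

lemma (in prob_space) expectation_eq_integral_tail:
  fixes Y :: "'a \<Rightarrow> real"
  assumes [measurable]: "Y \<in> borel_measurable M"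
    and bounds: "\<And>\<omega>. \<omega> \<in> space M \<Longrightarrow> Y \<omega> \<in> {0..1}"
    and tail: "\<And>t. 0 < t \<Longrightarrow> t < 1 \<Longrightarrow> prob {\<omega>\<in>space M. t < Y \<omega>} = g t"
    and g: "(g has_integral c) {0<..<1}"
  shows "expectation Y = c"
proof -
  interpret pair_sigma_finite lborel M ..
  \<comment> \<open>\<open>g\<close> is known to be a probability only on (0, 1); cutting it off
    outside makes it nonnegative everywhere without changing the integral.\<close>
  define h where "h t = (if 0 < t \<and> t < 1 then g t else 0)" for t
  have h_nonneg: "0 \<le> h t" for t
    using tail[of t, symmetric] by (simp add: h_def)
  have h_int: "(h has_integral c) {0<..<1}"
    using g by (rule has_integral_eq[rotated]) (auto simp: h_def)
  have c_nonneg: "0 \<le> c"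
    using has_integral_nonneg[OF h_int] h_nonneg by auto
  have "ennreal (expectation Y) = (\<integral>\<^sup>+\<omega>. ennreal (Y \<omega>) \<partial>M)"
    using bounds by (intro nn_integral_eq_integral[symmetric] integrable_const_bound[of _ 1]) auto
  also have "\<dots> = (\<integral>\<^sup>+\<omega>. (\<integral>\<^sup>+t. indicator {p. 0 < fst p \<and> fst p < 1 \<and> fst p < Y (snd p)} (t, \<omega>) \<partial>lborel) \<partial>M)"
  proof (intro nn_integral_cong)
    fix \<omega> assume "\<omega> \<in> space M"
    then have Y: "0 \<le> Y \<omega>" "Y \<omega> \<le> 1"
      using bounds by auto
    have "(\<integral>\<^sup>+t. indicator {p. 0 < fst p \<and> fst p < 1 \<and> fst p < Y (snd p)} (t, \<omega>) \<partial>lborel) =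
        (\<integral>\<^sup>+t. indicator {0<..<Y \<omega>} t \<partial>lborel)"
      using Y by (intro nn_integral_cong) (auto simp: indicator_def)
    then show "ennreal (Y \<omega>) = (\<integral>\<^sup>+t. indicator {p. 0 < fst p \<and> fst p < 1 \<and> fst p < Y (snd p)} (t, \<omega>) \<partial>lborel)"
      using Y by simp
  qed
  also have "\<dots> = (\<integral>\<^sup>+t. (\<integral>\<^sup>+\<omega>. indicator {p. 0 < fst p \<and> fst p < 1 \<and> fst p < Y (snd p)} (t, \<omega>) \<partial>M) \<partial>lborel)"
    by (intro Fubini') measurable
  also have "\<dots> = (\<integral>\<^sup>+t. ennreal (indicator {0<..<1} t * h t) \<partial>lborel)"
  proof (intro nn_integral_cong)
    fix t :: real
    have "(\<integral>\<^sup>+\<omega>. indicator {p. 0 < fst p \<and> fst p < 1 \<and> fst p < Y (snd p)} (t, \<omega>) \<partial>M) =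
        (\<integral>\<^sup>+\<omega>. indicator {0<..<1} t * indicator {\<omega>\<in>space M. t < Y \<omega>} \<omega> \<partial>M)"
      by (intro nn_integral_cong) (auto simp: indicator_def)
    also have "\<dots> = ennreal (indicator {0<..<1} t * h t)"
      using tail[of t]
      by (subst nn_integral_cmult) (auto simp: emeasure_eq_measure h_def indicator_def)
    finally show "(\<integral>\<^sup>+\<omega>. indicator {p. 0 < fst p \<and> fst p < 1 \<and> fst p < Y (snd p)} (t, \<omega>) \<partial>M) =
        ennreal (indicator {0<..<1} t * h t)" .
  qed
  also have "\<dots> = ennreal c"
    using nn_integral_has_integral_lebesgue[OF h_nonneg h_int] by simp
  finally show ?thesis
    using c_nonneg bounds by (subst (asm) ennreal_inj) (auto intro!: integral_nonneg_AE)
qed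

lemma (in prob_space) expectation_order_statistic_uniform:
  assumes indep: "indep_vars (\<lambda>_. borel) U {1..n}"
    and bounds: "\<And>k \<omega>. k \<in> {1..n} \<Longrightarrow> \<omega> \<in> space M \<Longrightarrow> U k \<omega> \<in> {0..1}"
    and unif: "\<And>k t. k \<in> {1..n} \<Longrightarrow> 0 < t \<Longrightarrow> t < 1 \<Longrightarrow> prob {\<omega>\<in>space M. U k \<omega> \<le> t} = t"
    and r: "r \<in> {1..n}"
  shows "expectation (\<lambda>\<omega>. order_statistic n (\<lambda>k. U k \<omega>) r) = real r / (real n + 1)"
proof (rule expectation_eq_integral_tail)
  define C where "C t \<omega> = card {k\<in>{1..n}. U k \<omega> \<in> {..t}}" for t \<omega>
  have [measurable]: "U k \<in> borel_measurable M" if "k \<in> {1..n}" for k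
    using indep that by (auto simp: indep_vars_def)
  have C_meas [measurable]: "C t \<in> measurable M (count_space UNIV)" for t
    unfolding C_def by measurable
  \<comment> \<open>This disjoint decomposition yields both the measurability of the order statistic
    and its tail as a sum of binomial probabilities.\<close>
  have tail_eq: "{\<omega>\<in>space M. t < order_statistic n (\<lambda>k. U k \<omega>) r} = (\<Union>j<r. {\<omega>\<in>space M. C t \<omega> = j})" for t
    unfolding C_def less_order_statistic_iff[OF r] by auto
  show "(\<lambda>\<omega>. order_statistic n (\<lambda>k. U k \<omega>) r) \<in> borel_measurable M"
    unfolding borel_measurable_iff_greater tail_eq by auto
  show "order_statistic n (\<lambda>k. U k \<omega>) r \<in> {0..1}" if "\<omega> \<in> space M" for \<omega>
    using bounds that by (intro order_statistic_in[OF r]) auto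
  show "prob {\<omega>\<in>space M. t < order_statistic n (\<lambda>k. U k \<omega>) r} =
      (\<Sum>j<r. real (n choose j) * t ^ j * (1 - t) ^ (n - j))" if t: "0 < t" "t < 1" for t
  proof -
    have p: "prob (U k -` {..t} \<inter> space M) = t" if "k \<in> {1..n}" for k
      using unif[OF that t] by (simp add: vimage_def Int_def conj_commute)
    have "prob {\<omega>\<in>space M. t < order_statistic n (\<lambda>k. U k \<omega>) r} = (\<Sum>j<r. prob {\<omega>\<in>space M. C t \<omega> = j})"
      unfolding tail_eq by (intro finite_measure_finite_Union) (auto simp: disjoint_family_on_def)
    also have "\<dots> = (\<Sum>j<r. real (n choose j) * t ^ j * (1 - t) ^ (n - j))"
      unfolding C_def using p by (subst prob_card_eq_binomial[OF indep]) auto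
    finally show ?thesis .
  qed
  have "((\<lambda>t. \<Sum>j<r. real (n choose j) * t ^ j * (1 - t) ^ (n - j)) has_integral
      (\<Sum>j<r. 1 / (real n + 1))) {0<..<1}"
    using r by (intro has_integral_sum has_integral_Bernstein) auto
  then show "((\<lambda>t. \<Sum>j<r. real (n choose j) * t ^ j * (1 - t) ^ (n - j)) has_integral
      real r / (real n + 1)) {0<..<1}"
    by simp
qed

theorem proposition1:
  fixes M :: "'a measure" and X :: "nat \<Rightarrow> 'a \<Rightarrow> real" and D :: "real measure"
    and F :: "real \<Rightarrow> real" and n :: nat
  assumes "prob_space M"
    and "n \<ge> 1"
    and "prob_space.indep_vars M (\<lambda>_. borel) X {1..n}"
    and "\<And>k. k \<in> {1..n} \<Longrightarrow> distr M borel (X k) = D"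
    and "F = cdf D"
    and "continuous_on UNIV F"
  shows "\<forall>i\<in>{1..n}. \<forall>r\<in>{1..n}. \<forall>\<omega>\<in>space M.
           sample_rank n (\<lambda>k. X k \<omega>) i = r \<longrightarrow>
             pseudo_observation n (\<lambda>k. X k \<omega>) i = real r / (real n + 1) \<and>
             real r / (real n + 1) =
               prob_space.expectation M (\<lambda>\<omega>'. order_statistic n (\<lambda>k. F (X k \<omega>')) r)"
proof -
  interpret prob_space M by fact
  have X_meas [measurable]: "X k \<in> borel_measurable M" if "k \<in> {1..n}" for k
    using assms(3) that by (auto simp: indep_vars_def)
  \<comment> \<open>\<open>D\<close> is given only as the common law of the sample; since n is at
    least 1, it inherits from \<open>X 1\<close> that it is a probability measure.\<close>
  have "real_distribution (distr M borel (X 1))"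
    using \<open>n \<ge> 1\<close> by (intro real_distribution_distr X_meas) auto
  then have "real_distribution D"
    using assms(4)[of 1] \<open>n \<ge> 1\<close> by (metis atLeastAtMost_iff order_refl)
  then interpret D: real_distribution D .
  have F_meas [measurable]: "F \<in> borel_measurable borel"
    using assms(6) by (rule borel_measurable_continuous_onI)
  have expectation_eq: "expectation (\<lambda>\<omega>. order_statistic n (\<lambda>k. F (X k \<omega>)) r) = real r / (real n + 1)"
    if "r \<in> {1..n}" for r
  proof (rule expectation_order_statistic_uniform[OF _ _ _ that])
    show "indep_vars (\<lambda>_. borel) (\<lambda>k \<omega>. F (X k \<omega>)) {1..n}"
      using assms(3) by (rule indep_vars_compose2) simp
    show "F (X k \<omega>) \<in> {0..1}" for k \<omega>
      using D.cdf_bounded_prob by (auto simp: assms(5) D.cdf_nonneg)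
    show "prob {\<omega>\<in>space M. F (X k \<omega>) \<le> t} = t" if k: "k \<in> {1..n}" and t: "0 < t" "t < 1" for k t
    proof -
      have "prob {\<omega>\<in>space M. F (X k \<omega>) \<le> t} = measure (distr M borel (X k)) {x. F x \<le> t}"
        using k by (subst measure_distr) (auto simp: vimage_def Int_def conj_commute)
      then show ?thesis
        using D.prob_cdf_le[OF _ t] assms(4)[OF k] assms(5,6) by simp
    qed
  qed
  \<comment> \<open>On the event, the first equality is the definition of the pseudo-observation;
    the second is \<open>expectation_eq\<close>, where r is a fixed number and not the random
    rank.\<close>
  show ?thesis
    by (auto simp: pseudo_observation_def expectation_eq)
qed

end
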